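(* There are metric spaces $X_1,X_2$ satisfying $$\operatorname{asdim}_{AN}(X_1\times X_2)<\operatorname{asdim}_{AN}X_1+\operatorname{asdim}_{AN}X_2 .$$
   Context: The product $X_1\times X_2$ of metric spaces $(X_1,d_1),(X_2,d_2)$ carries the metric $d(x,y)=\max\{d_1(x_1,y_1),d_2(x_2,y_2)\}$. Write $\mathbb{R}_+=[0,\infty)$. An $n$-dimensional control function for a metric space $X$ is any function $D_X\colon\mathbb{R}_+\to\mathbb{R}_+\cup\{\infty\}$ such that for every $r\in\mathbb{R}_+$ there is a cover $\mathcal U=\bigcup_{i=1}^{n+1}\mathcal U_i$ of $X$ such that each family $\mathcal U_i$ is $r$-disjoint (points lying in distinct members of $\mathcal U_i$ are at distance at least $r$) and the diameter of every element of $\mathcal U$ is at most $D_X(r)$. The asymptotic Assouad-Nagata dimension satisfies $\operatorname{asdim}_{AN}X\le n$ if $X$ has an affine $n$-dimensional control function ($r\mapsto Ar+B$ with real $A,B$); $\operatorname{asdim}_{AN}X$ is the least integer $n\ge0$ with $\operatorname{asdim}_{AN}X\le n$, and $\infty$ if there is none. *)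

theory Defs
  imports "HOL-Analysis.Analysis"
begin

(* The library's prod_metric is the Euclidean (square root) product. *)
definition max_dist ::
  "('a \<Rightarrow> 'a \<Rightarrow> real) \<Rightarrow> ('b \<Rightarrow> 'b \<Rightarrow> real) \<Rightarrow> 'a \<times> 'b \<Rightarrow> 'a \<times> 'b \<Rightarrow> real" where
  "max_dist d1 d2 x y = max (d1 (fst x) (fst y)) (d2 (snd x) (snd y))"

definition max_prod_metric :: "'a metric \<Rightarrow> 'b metric \<Rightarrow> ('a \<times> 'b) metric" where
  "max_prod_metric X1 X2 =
     metric (mspace X1 \<times> mspace X2, max_dist (mdist X1) (mdist X2))"

lemma Metric_space_max_dist:
  "Metric_space (mspace X1 \<times> mspace X2) (max_dist (mdist X1) (mdist X2))"
proof
  show "0 \<le> max_dist (mdist X1) (mdist X2) x y" for x y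
    by (simp add: max_dist_def le_max_iff_disj)
  show "max_dist (mdist X1) (mdist X2) x y = max_dist (mdist X1) (mdist X2) y x" for x y
    by (simp add: max_dist_def mdist_commute)
  show "(max_dist (mdist X1) (mdist X2) x y = 0) = (x = y)"
    if "x \<in> mspace X1 \<times> mspace X2" "y \<in> mspace X1 \<times> mspace X2" for x y
  proof
    assume "max_dist (mdist X1) (mdist X2) x y = 0"
    then have "mdist X1 (fst x) (fst y) \<le> 0" "mdist X2 (snd x) (snd y) \<le> 0"
      by (simp_all add: max_dist_def)
    then have "mdist X1 (fst x) (fst y) = 0" "mdist X2 (snd x) (snd y) = 0"
      by (simp_all add: order_antisym)
    with that show "x = y"
      by (auto simp: mem_Times_iff prod_eq_iff)
  next
    assume "x = y"
    with that have "mdist X1 (fst x) (fst y) = 0" "mdist X2 (snd x) (snd y) = 0"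
      by (auto simp: mem_Times_iff)
    then show "max_dist (mdist X1) (mdist X2) x y = 0"
      by (simp add: max_dist_def)
  qed
  show "max_dist (mdist X1) (mdist X2) x z
          \<le> max_dist (mdist X1) (mdist X2) x y + max_dist (mdist X1) (mdist X2) y z"
    if "x \<in> mspace X1 \<times> mspace X2" "y \<in> mspace X1 \<times> mspace X2"
      "z \<in> mspace X1 \<times> mspace X2" for x y z
    using that mdist_triangle[of "fst x" X1 "fst y" "fst z"]
      mdist_triangle[of "snd x" X2 "snd y" "snd z"]
    by (auto simp: max_dist_def mem_Times_iff max_def)
qed

lemma mspace_max_prod_metric [simp]:
  "mspace (max_prod_metric X1 X2) = mspace X1 \<times> mspace X2"
  by (simp add: max_prod_metric_def Metric_space.mspace_metric[OF Metric_space_max_dist])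

lemma mdist_max_prod_metric [simp]:
  "mdist (max_prod_metric X1 X2) = max_dist (mdist X1) (mdist X2)"
  by (simp add: max_prod_metric_def Metric_space.mdist_metric[OF Metric_space_max_dist])

definition r_disjoint :: "'a metric \<Rightarrow> real \<Rightarrow> 'a set set \<Rightarrow> bool" where
  "r_disjoint X r \<U> \<longleftrightarrow>
     (\<forall>U\<in>\<U>. \<forall>V\<in>\<U>. U \<noteq> V \<longrightarrow> (\<forall>x\<in>U. \<forall>y\<in>V. r \<le> mdist X x y))"

(* Extended-valued, so that unbounded sets have diameter \<infinity>; the library's real-valued
   diameter is unspecified on them. *)
definition mdiam :: "'a metric \<Rightarrow> 'a set \<Rightarrow> ennreal" where
  "mdiam X U = (SUP x\<in>U. SUP y\<in>U. ennreal (mdist X x y))"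

(* Only the values of D on [0, \<infinity>) matter. *)
definition control_function :: "nat \<Rightarrow> 'a metric \<Rightarrow> (real \<Rightarrow> ennreal) \<Rightarrow> bool" where
  "control_function n X D \<longleftrightarrow>
     (\<forall>r\<ge>0. \<exists>\<U> :: nat \<Rightarrow> 'a set set.
        (\<Union>i\<in>{1..n+1}. \<Union>(\<U> i)) = mspace X \<and>
        (\<forall>i\<in>{1..n+1}. r_disjoint X r (\<U> i) \<and> (\<forall>U\<in>\<U> i. mdiam X U \<le> D r)))"

(* The nonnegativity condition says that r \<mapsto> A r + B maps [0, \<infinity>) to itself; ennreal would
   otherwise truncate negative values to 0. *)
definition asdim_AN_le :: "'a metric \<Rightarrow> nat \<Rightarrow> bool" where
  "asdim_AN_le X n \<longleftrightarrow>
     (\<exists>(A :: real) (B :: real). (\<forall>r\<ge>0. 0 \<le> A * r + B) \<and>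
        control_function n X (\<lambda>r. ennreal (A * r + B)))"

definition asdim_AN :: "'a metric \<Rightarrow> enat" where
  "asdim_AN X =
     (if \<exists>n. asdim_AN_le X n then enat (LEAST n. asdim_AN_le X n) else \<infinity>)"

end

theory Submission
  imports Defs "HOL-Library.Discrete_Functions"
begin

text \<open>
  For a set \<open>S\<close> of digit positions let \<open>X\<^sub>S\<close> be the set of natural numbers all of whose nonzero
  binary digits have position in \<open>S\<close>. If \<open>S\<close> contains arbitrarily long runs of consecutive
  positions, then \<open>X\<^sub>S\<close> contains arbitrarily long arithmetic progressions starting at \<open>0\<close> whose
  step is a power of two, so it does not have dimension \<open>0\<close>. Now let both \<open>S\<close> and its complement
  \<open>T\<close> have long runs. Cut \<open>X\<^sub>S \<times> X\<^sub>T\<close> at scale \<open>r \<approx> 2 ^ p\<close> into dyadic squares of side \<open>2 ^ p\<close>.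
  As \<open>p\<close> is missing from \<open>S\<close> or from \<open>T\<close>, one of the two coordinates of the squares that occur
  is always even, hence colouring a square by the parity of the sum of its coordinates is enough to
  separate squares of equal colour: the product has dimension at most \<open>1\<close>.
\<close>

section \<open>Covers given by a colouring and a labelling\<close>

lemma control_function_colouringI:
  fixes colour :: "real \<Rightarrow> 'a \<Rightarrow> nat" and label :: "real \<Rightarrow> 'a \<Rightarrow> 'b"
  assumes colour: "\<And>r x. 0 \<le> r \<Longrightarrow> x \<in> mspace X \<Longrightarrow> colour r x \<in> {1..n + 1}"
    and close: "\<And>r x y. 0 \<le> r \<Longrightarrow> x \<in> mspace X \<Longrightarrow> y \<in> mspace X \<Longrightarrow>
          label r x = label r y \<Longrightarrow> ennreal (mdist X x y) \<le> D r"
    and apart: "\<And>r x y. 0 \<le> r \<Longrightarrow> x \<in> mspace X \<Longrightarrow> y \<in> mspace X \<Longrightarrow>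
          colour r x = colour r y \<Longrightarrow> label r x \<noteq> label r y \<Longrightarrow> r \<le> mdist X x y"
  shows "control_function n X D"
  unfolding control_function_def
proof (intro allI impI)
  fix r :: real
  assume r: "0 \<le> r"
  \<comment> \<open>\<open>colour\<close> selects the family, \<open>label\<close> the member. Empty
    members do no harm: their diameter is 0.\<close>
  define \<U> where
    "\<U> i = range (\<lambda>l. {x \<in> mspace X. colour r x = i \<and> label r x = l})" for i
  show "\<exists>\<U>. (\<Union>i\<in>{1..n + 1}. \<Union>(\<U> i)) = mspace X \<and>
      (\<forall>i\<in>{1..n + 1}. r_disjoint X r (\<U> i) \<and> (\<forall>U\<in>\<U> i. mdiam X U \<le> D r))"
  proof (intro exI[of _ \<U>] conjI ballI)
    show "(\<Union>i\<in>{1..n + 1}. \<Union>(\<U> i)) = mspace X"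
      using colour[OF r] by (auto simp: \<U>_def)
    show "r_disjoint X r (\<U> i)" for i
      unfolding r_disjoint_def \<U>_def by (auto intro!: apart[OF r])
    show "mdiam X U \<le> D r" if "U \<in> \<U> i" for U i
      using that unfolding mdiam_def \<U>_def by (auto intro!: SUP_least close[OF r])
  qed
qed

section \<open>Upper and lower bounds on the dimension\<close>

lemma asdim_AN_leI:
  assumes "asdim_AN_le X n"
  shows "asdim_AN X \<le> enat n"
  using assms by (auto simp: asdim_AN_def intro: Least_le)

lemma asdim_AN_ge_1:
  assumes "\<not> asdim_AN_le X 0"
  shows "1 \<le> asdim_AN X"
proof (cases "\<exists>n. asdim_AN_le X n")
  case True
  then have "asdim_AN_le X (LEAST n. asdim_AN_le X n)"
    by (rule LeastI_ex)
  with assms have "(LEAST n. asdim_AN_le X n) \<noteq> 0"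
    by metis
  with True show ?thesis
    by (simp add: asdim_AN_def one_enat_def)
qed (simp add: asdim_AN_def)

text \<open>A \<open>2 * s\<close>-disjoint cover cannot separate consecutive terms of a progression
  with step \<open>s\<close>, so a single member contains all of it, and a long progression violates
  the affine bound.\<close>

lemma not_asdim_AN_le_0I:
  fixes X :: "real metric"
  assumes dist: "mdist X = dist"
    and progression: "\<And>N :: nat. \<exists>s\<ge>1. \<forall>j\<le>N. real j * s \<in> mspace X"
  shows "\<not> asdim_AN_le X 0"
proof
  assume "asdim_AN_le X 0"
  then obtain A B :: real where nonneg: "\<And>r. 0 \<le> r \<Longrightarrow> 0 \<le> A * r + B"
    and ctrl: "control_function 0 X (\<lambda>r. ennreal (A * r + B))"
    unfolding asdim_AN_le_def by blast
  \<comment> \<open>\<open>N\<close> has to be fixed before \<open>s\<close>. As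
    \<open>1 \<le> s\<close>, the diameter bound at scale \<open>2 * s\<close> is at most
    \<open>(2 * \<bar>A\<bar> + \<bar>B\<bar>) * s\<close>, hence below
    \<open>N * s\<close>.\<close>
  obtain N :: nat where N: "2 * \<bar>A\<bar> + \<bar>B\<bar> < real N"
    using reals_Archimedean2 by blast
  obtain s where s: "1 \<le> s" and mem: "\<And>j. j \<le> N \<Longrightarrow> real j * s \<in> mspace X"
    using progression by blast
  obtain \<U> :: "nat \<Rightarrow> real set set" where cover: "\<Union>(\<U> 1) = mspace X"
    and disj: "r_disjoint X (2 * s) (\<U> 1)"
    and diam: "\<And>U. U \<in> \<U> 1 \<Longrightarrow> mdiam X U \<le> ennreal (A * (2 * s) + B)"
    using ctrl[unfolded control_function_def, rule_format, of "2 * s"] s by auto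
  obtain U where U: "U \<in> \<U> 1" "0 \<in> U"
    using cover mem[of 0] by auto
  have chain: "j \<le> N \<Longrightarrow> real j * s \<in> U" for j
  proof (induction j)
    case (Suc j)
    obtain V where V: "V \<in> \<U> 1" "real (Suc j) * s \<in> V"
      using cover mem[OF Suc.prems] by blast
    have "\<not> 2 * s \<le> mdist X (real j * s) (real (Suc j) * s)"
      using s by (simp add: dist dist_real_def algebra_simps)
    with disj Suc U V show ?case
      unfolding r_disjoint_def by (metis Suc_leD)
  qed (use U in simp)
  have "ennreal (real N * s) = ennreal (mdist X 0 (real N * s))"
    using s by (simp add: dist)
  also have "\<dots> \<le> mdiam X U"
    unfolding mdiam_def by (intro SUP_upper2[of 0] SUP_upper2[of "real N * s"] U chain) auto
  also have "\<dots> \<le> ennreal (A * (2 * s) + B)"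
    by (rule diam[OF U(1)])
  \<comment> \<open>\<open>ennreal\<close> sends negative numbers to 0; nonnegativity of the bound
    lets the inequality pass to the reals.\<close>
  finally have "real N * s \<le> A * (2 * s) + B"
    using nonneg[of "2 * s"] s by (simp add: ennreal_le_iff)
  also have "\<dots> \<le> \<bar>A\<bar> * (2 * s) + \<bar>B\<bar> * s"
  proof (rule add_mono)
    show "A * (2 * s) \<le> \<bar>A\<bar> * (2 * s)"
      using s by (intro mult_right_mono) auto
    have "\<bar>B\<bar> * 1 \<le> \<bar>B\<bar> * s"
      using s by (intro mult_left_mono) auto
    then show "B \<le> \<bar>B\<bar> * s"
      by linarith
  qed
  also have "\<dots> = (2 * \<bar>A\<bar> + \<bar>B\<bar>) * s"
    by (simp add: algebra_simps)
  finally show False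
    using N s by simp
qed

section \<open>Numbers with restricted binary digits\<close>

definition digit_space :: "nat set \<Rightarrow> real metric" where
  "digit_space S = submetric euclidean_metric (real ` {n. \<forall>i. bit n i \<longrightarrow> i \<in> S})"

lemma mspace_digit_space: "mspace (digit_space S) = real ` {n. \<forall>i. bit n i \<longrightarrow> i \<in> S}"
  by (simp add: digit_space_def)

lemma mdist_digit_space: "mdist (digit_space S) = dist"
  by (simp add: digit_space_def)

lemma digit_space_nonempty: "mspace (digit_space S) \<noteq> {}"
  by (auto simp: mspace_digit_space intro: exI[of _ 0])

lemma not_asdim_AN_le_0_digit_space:
  assumes runs: "\<And>k. \<exists>p. {p..<p + k} \<subseteq> S"
  shows "\<not> asdim_AN_le (digit_space S) 0"
proof (rule not_asdim_AN_le_0I)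
  show "mdist (digit_space S) = dist"
    by (rule mdist_digit_space)
  fix N :: nat
  obtain p where p: "{p..<p + N} \<subseteq> S"
    using runs by blast
  show "\<exists>s\<ge>1. \<forall>j\<le>N. real j * s \<in> mspace (digit_space S)"
  proof (intro exI[of _ "2 ^ p"] conjI allI impI)
    fix j :: nat
    assume "j \<le> N"
    \<comment> \<open>Hence \<open>j\<close> has digits only below position \<open>N\<close>, and
      multiplying by \<open>2 ^ p\<close> shifts them into the run.\<close>
    also have "N < 2 ^ N"
      by (rule less_exp)
    finally have j: "take_bit N j = j"
      by (simp add: take_bit_nat_eq_self)
    have "i \<in> S" if "bit (push_bit p j) i" for i
    proof -
      have "p \<le> i" and "bit (take_bit N j) (i - p)"
        using that by (auto simp: bit_push_bit_iff j)
      then have "i \<in> {p..<p + N}"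
        by (auto simp: bit_take_bit_iff)
      with p show ?thesis
        by blast
    qed
    moreover have "real j * 2 ^ p = real (push_bit p j)"
      by (simp add: push_bit_eq_mult)
    ultimately show "real j * 2 ^ p \<in> mspace (digit_space S)"
      unfolding mspace_digit_space by blast
  qed simp
qed

section \<open>Dyadic blocks and the upper bound for the product\<close>

lemma dist_same_dyadic_block:
  fixes m n p :: nat
  assumes "m div 2 ^ p = n div 2 ^ p"
  shows "dist (real m) (real n) \<le> 2 ^ p"
proof -
  have "m = 2 ^ p * (n div 2 ^ p) + m mod 2 ^ p"
    using assms by (metis mult_div_mod_eq)
  moreover have "n = 2 ^ p * (n div 2 ^ p) + n mod 2 ^ p"
    by simp
  moreover have "m mod 2 ^ p < 2 ^ p" "n mod 2 ^ p < 2 ^ p"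
    by simp_all
  ultimately have "m \<le> n + 2 ^ p" "n \<le> m + 2 ^ p"
    by linarith+
  then have "real m \<le> real (n + 2 ^ p)" "real n \<le> real (m + 2 ^ p)"
    by (simp_all only: of_nat_le_iff)
  then show ?thesis
    by (simp add: dist_real_def)
qed

text \<open>Distinct quotients of equal parity differ by at least 2, so a whole block of length
  \<open>2 ^ p\<close> lies between \<open>m\<close> and \<open>n\<close>.\<close>

lemma dist_dyadic_blocks_same_parity:
  fixes m n p :: nat
  assumes "m div 2 ^ p \<noteq> n div 2 ^ p" "even (m div 2 ^ p) \<longleftrightarrow> even (n div 2 ^ p)"
  shows "2 ^ p \<le> dist (real m) (real n)"
  using assms
proof (induction "m div 2 ^ p" "n div 2 ^ p" arbitrary: m n rule: linorder_wlog)
  case le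
  moreover have "a + 2 \<le> b" if "a \<le> b" "a \<noteq> b" "even a \<longleftrightarrow> even b" for a b :: nat
    using that by presburger
  ultimately have "m div 2 ^ p + 2 \<le> n div 2 ^ p"
    by blast
  then have "(m div 2 ^ p + 2) * 2 ^ p \<le> n div 2 ^ p * 2 ^ p"
    by (rule mult_right_mono) simp
  also have "\<dots> \<le> n"
    by simp
  finally have "(m div 2 ^ p) * 2 ^ p + 2 ^ p + 2 ^ p \<le> n"
    by (simp add: algebra_simps)
  moreover have "m < 2 ^ p + (m div 2 ^ p) * 2 ^ p"
    by (rule dividend_less_div_times) simp
  ultimately have "m + 2 ^ p \<le> n"
    by linarith
  then have "real (m + 2 ^ p) \<le> real n"
    by (simp only: of_nat_le_iff)
  then show ?case
    by (simp add: dist_real_def)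
next
  case (sym m n)
  then show ?case
    by (metis dist_commute)
qed

lemma asdim_AN_le_1_prod_digit_space:
  assumes "S \<inter> T = {}"
  shows "asdim_AN_le (max_prod_metric (digit_space S) (digit_space T)) 1"
proof -
  define p where "p r = (LEAST p. r \<le> 2 ^ p)" for r :: real
  have p_ge: "r \<le> 2 ^ p r" for r
  proof -
    have "\<exists>p. r \<le> 2 ^ p"
      using real_arch_pow[of 2 r] by (auto intro: less_imp_le)
    then show ?thesis
      unfolding p_def by (rule LeastI_ex)
  qed
  \<comment> \<open>Minimality gives \<open>2 ^ q < r\<close> when \<open>p r = Suc q\<close>; the
    summand 1 covers \<open>p r = 0\<close>.\<close>
  have p_le: "2 ^ p r \<le> 2 * r + 1" if "0 \<le> r" for r
  proof (cases "p r")
    case (Suc q)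
    then have "\<not> r \<le> 2 ^ q"
      unfolding p_def by (metis lessI not_less_Least)
    with Suc show ?thesis
      by simp
  qed (use that in simp)
  \<comment> \<open>Points are natural numbers viewed as reals;
    \<open>nat \<lfloor>x\<rfloor>\<close> recovers the number.\<close>
  define block where "block r x = nat \<lfloor>x\<rfloor> div 2 ^ p r" for r x :: real
  define label where "label r z = (block r (fst z), block r (snd z))" for r z
  define colour where "colour r z = (block r (fst z) + block r (snd z)) mod 2 + 1" for r z
  have block_real: "block r (real n) = n div 2 ^ p r" for r n
    by (simp add: block_def)
  \<comment> \<open>The parity of \<open>n div 2 ^ p r\<close> is the binary digit of
    \<open>n\<close> at position \<open>p r\<close>.\<close>
  have even_block: "even (block r x)" if "x \<in> mspace (digit_space S)" "p r \<notin> S" for r x S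
    using that by (auto simp: mspace_digit_space block_real bit_iff_odd)
  have near: "dist x y \<le> 2 * r + 1"
    if "0 \<le> r" "x \<in> mspace (digit_space S)" "y \<in> mspace (digit_space S)" "block r x = block r y"
    for r x y S
    using that dist_same_dyadic_block[of _ "p r"] p_le[of r]
    by (fastforce simp: mspace_digit_space block_real)
  have far: "r \<le> dist x y"
    if "x \<in> mspace (digit_space S)" "y \<in> mspace (digit_space S)" "block r x \<noteq> block r y"
      "even (block r x) \<longleftrightarrow> even (block r y)"
    for r x y S
    using that dist_dyadic_blocks_same_parity[of _ "p r"] p_ge[of r]
    by (fastforce simp: mspace_digit_space block_real)
  have "control_function 1 (max_prod_metric (digit_space S) (digit_space T))
      (\<lambda>r. ennreal (2 * r + 1))"
  proof (rule control_function_colouringI[where colour = colour and label = label])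
    fix r :: real and z w
    assume r: "0 \<le> r"
    assume z: "z \<in> mspace (max_prod_metric (digit_space S) (digit_space T))"
    then show "colour r z \<in> {1..1 + 1}"
      by (auto simp: colour_def)
    assume w: "w \<in> mspace (max_prod_metric (digit_space S) (digit_space T))"
    note mem = z w
    show "ennreal (mdist (max_prod_metric (digit_space S) (digit_space T)) z w)
        \<le> ennreal (2 * r + 1)" if "label r z = label r w"
      using that mem r near[of r "fst z" S "fst w"] near[of r "snd z" T "snd w"]
      by (intro ennreal_leI)
        (auto simp: label_def max_dist_def mdist_digit_space mem_Times_iff)
    show "r \<le> mdist (max_prod_metric (digit_space S) (digit_space T)) z w"
      if "colour r z = colour r w" "label r z \<noteq> label r w"
    proof -
      have sum: "even (block r (fst z) + block r (snd z)) \<longleftrightarrow>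
          even (block r (fst w) + block r (snd w))"
        using that(1) by (simp add: colour_def even_iff_mod_2_eq_zero)
      \<comment> \<open>In one coordinate both blocks are even, so equal parity of the sums forces
        equal parity in the other.\<close>
      have parity: "(even (block r (fst z)) \<longleftrightarrow> even (block r (fst w))) \<and>
          (even (block r (snd z)) \<longleftrightarrow> even (block r (snd w)))"
      proof (cases "p r \<in> S")
        case True
        then have "p r \<notin> T"
          using assms by blast
        then have "even (block r (snd z))" "even (block r (snd w))"
          using mem even_block[of _ T r] by (auto simp: mem_Times_iff)
        with sum show ?thesis
          by simp
      next
        case False
        then have "even (block r (fst z))" "even (block r (fst w))"
          using mem even_block[of _ S r] by (auto simp: mem_Times_iff)
        with sum show ?thesis
          by simp
      qed
      \<comment> \<open>In the maximum metric, one coordinate with distinct blocks suffices.\<close>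
      show ?thesis
        using that(2) parity mem far[of "fst z" S "fst w" r] far[of "snd z" T "snd w" r]
        by (auto simp: label_def max_dist_def mdist_digit_space mem_Times_iff le_max_iff_disj)
    qed
  qed
  then show ?thesis
    unfolding asdim_AN_le_def by (intro exI[of _ 2] exI[of _ 1]) auto
qed

section \<open>Two complementary sets of positions with long runs\<close>

lemma floor_log_run:
  assumes "i \<in> {2 ^ m..<2 ^ m + 2 ^ m}"
  shows "floor_log i = m"
  using assms by (intro floor_log_eqI) auto

theorem theorem3p1:
  shows "\<exists>(X1 :: real metric) (X2 :: real metric). mspace X1 \<noteq> {} \<and> mspace X2 \<noteq> {} \<and>
           asdim_AN (max_prod_metric X1 X2) < asdim_AN X1 + asdim_AN X2"
proof -
  \<comment> \<open>\<open>floor_log\<close> is constant on each interval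
    \<open>{2 ^ m..<2 ^ m + 2 ^ m}\<close>. These intervals go alternately to \<open>S\<close> and
    \<open>T\<close>, so both contain runs of every length.\<close>
  define S T where "S = {i. even (floor_log i)}" and "T = {i. odd (floor_log i)}"
  have "{2 ^ (2 * k)..<2 ^ (2 * k) + k} \<subseteq> S" for k
  proof -
    have "k \<le> 2 ^ (2 * k)"
      using less_exp[of "2 * k"] by linarith
    then show ?thesis
      using floor_log_run[of _ "2 * k"] by (fastforce simp: S_def)
  qed
  then have S: "1 \<le> asdim_AN (digit_space S)"
    by (intro asdim_AN_ge_1 not_asdim_AN_le_0_digit_space) blast
  have "{2 ^ (2 * k + 1)..<2 ^ (2 * k + 1) + k} \<subseteq> T" for k
  proof -
    have "k \<le> 2 ^ (2 * k + 1)"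
      using less_exp[of "2 * k + 1"] by linarith
    then show ?thesis
      using floor_log_run[of _ "2 * k + 1"] by (fastforce simp: T_def)
  qed
  then have T: "1 \<le> asdim_AN (digit_space T)"
    by (intro asdim_AN_ge_1 not_asdim_AN_le_0_digit_space) blast
  have "asdim_AN (max_prod_metric (digit_space S) (digit_space T)) \<le> enat 1"
    by (intro asdim_AN_leI asdim_AN_le_1_prod_digit_space) (auto simp: S_def T_def)
  also have "\<dots> < 1 + 1"
    by (simp add: one_enat_def)
  also have "\<dots> \<le> asdim_AN (digit_space S) + asdim_AN (digit_space T)"
    by (intro add_mono S T)
  finally show ?thesis
    using digit_space_nonempty by blast
qed

end
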